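(* Let $\mathbf R=(R,+,\cdot,0,1)$ be a specific RLSE. Then the associated orthomodular lattice $\mathbb L(\mathbf R)$ is a Boolean algebra if and only if $\mathbf R$ is a Boolean ring.
   Context: A ring-like structure of events (RLSE) is an algebra $(R,+,\cdot,0,1)$ of type $(2,2,0,0)$ such that $(R,\cdot,0,1)$ is a bounded meet-semilattice (i.e. $\cdot$ is associative, commutative and idempotent, $x0=0$ and $x1=x$ for all $x$) and the following hold for all $x,y\in R$ (multiplication binds more strongly than addition): (R1) $x+y=y+x$; (R2) $(xy+1)(x+1)+1=x$; (R3) $\big((xy+1)x+1\big)x=xy$; (R4) $xy+(x+1)=(xy+1)x+1$. An RLSE is called specific if in addition (R5) $x+y=x(y+1)+(x+1)y$ for all $x,y\in R$. $\mathbb L(\mathbf R)$ denotes the algebra $(R,\vee,\wedge,{}',0,1)$ with $x\vee y:=(x+1)(y+1)+1$, $x\wedge y:=xy$, $x':=x+1$; it is an orthomodular lattice for every RLSE $\mathbf R$. A Boolean ring is a ring $(R,+,\cdot,0,1)$ with unit $1$ in which $xx=x$ for all $x$. *)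

theory Defs
  imports "HOL-Algebra.Ring"
begin

section \<open>Ring-like structures of events\<close>

text \<open>
  Algebras \<open>(R, +, \<cdot>, 0, 1)\<close> are represented by records of type \<^typ>\<open>'a ring\<close>; the record type
  imposes no ring axioms. Addition of a ring-like structure of events need not be associative.
  \<^locale>\<open>comm_monoid\<close> together with \<open>mult_idem\<close> and \<open>mult_zero\<close> makes \<open>(R, \<cdot>, 0, 1)\<close>
  a bounded meet-semilattice.
\<close>

locale rlse = comm_monoid R for R (structure) +
  assumes add_closed: "\<lbrakk>x \<in> carrier R; y \<in> carrier R\<rbrakk> \<Longrightarrow> x \<oplus> y \<in> carrier R"
    and zero_in_carrier: "\<zero> \<in> carrier R"
    and mult_idem: "x \<in> carrier R \<Longrightarrow> x \<otimes> x = x"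
    and mult_zero: "x \<in> carrier R \<Longrightarrow> x \<otimes> \<zero> = \<zero>"
    and R1: "\<lbrakk>x \<in> carrier R; y \<in> carrier R\<rbrakk> \<Longrightarrow> x \<oplus> y = y \<oplus> x"
    and R2: "\<lbrakk>x \<in> carrier R; y \<in> carrier R\<rbrakk> \<Longrightarrow> (x \<otimes> y \<oplus> \<one>) \<otimes> (x \<oplus> \<one>) \<oplus> \<one> = x"
    and R3: "\<lbrakk>x \<in> carrier R; y \<in> carrier R\<rbrakk> \<Longrightarrow> ((x \<otimes> y \<oplus> \<one>) \<otimes> x \<oplus> \<one>) \<otimes> x = x \<otimes> y"
    and R4: "\<lbrakk>x \<in> carrier R; y \<in> carrier R\<rbrakk> \<Longrightarrow>
               x \<otimes> y \<oplus> (x \<oplus> \<one>) = (x \<otimes> y \<oplus> \<one>) \<otimes> x \<oplus> \<one>"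

locale specific_rlse = rlse +
  assumes R5: "\<lbrakk>x \<in> carrier R; y \<in> carrier R\<rbrakk> \<Longrightarrow>
               x \<oplus> y = x \<otimes> (y \<oplus> \<one>) \<oplus> (x \<oplus> \<one>) \<otimes> y"

locale boolean_ring = ring R for R (structure) +
  assumes idem: "x \<in> carrier R \<Longrightarrow> x \<otimes> x = x"


section \<open>Boolean algebras with an explicit carrier\<close>

record 'a ortho_algebra = "'a partial_object" +
  ljoin :: "['a, 'a] \<Rightarrow> 'a" (infixl \<open>\<curlyvee>\<index>\<close> 65)
  lmeet :: "['a, 'a] \<Rightarrow> 'a" (infixl \<open>\<curlywedge>\<index>\<close> 70)
  lcompl :: "'a \<Rightarrow> 'a"
  lzero :: 'a
  lone :: 'a

text \<open>
  The complement is part of the structure. The one-element algebra is not excluded, just as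
  \<^locale>\<open>ring\<close> does not exclude the zero ring.
\<close>

locale boolean_alg =
  fixes B (structure)
  assumes join_closed: "\<lbrakk>x \<in> carrier B; y \<in> carrier B\<rbrakk> \<Longrightarrow> x \<curlyvee> y \<in> carrier B"
    and meet_closed: "\<lbrakk>x \<in> carrier B; y \<in> carrier B\<rbrakk> \<Longrightarrow> x \<curlywedge> y \<in> carrier B"
    and compl_closed: "x \<in> carrier B \<Longrightarrow> lcompl B x \<in> carrier B"
    and lzero_closed: "lzero B \<in> carrier B"
    and lone_closed: "lone B \<in> carrier B"
    and join_assoc: "\<lbrakk>x \<in> carrier B; y \<in> carrier B; z \<in> carrier B\<rbrakk> \<Longrightarrow>
                       (x \<curlyvee> y) \<curlyvee> z = x \<curlyvee> (y \<curlyvee> z)"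
    and meet_assoc: "\<lbrakk>x \<in> carrier B; y \<in> carrier B; z \<in> carrier B\<rbrakk> \<Longrightarrow>
                       (x \<curlywedge> y) \<curlywedge> z = x \<curlywedge> (y \<curlywedge> z)"
    and join_comm: "\<lbrakk>x \<in> carrier B; y \<in> carrier B\<rbrakk> \<Longrightarrow> x \<curlyvee> y = y \<curlyvee> x"
    and meet_comm: "\<lbrakk>x \<in> carrier B; y \<in> carrier B\<rbrakk> \<Longrightarrow> x \<curlywedge> y = y \<curlywedge> x"
    and join_absorb: "\<lbrakk>x \<in> carrier B; y \<in> carrier B\<rbrakk> \<Longrightarrow> x \<curlyvee> (x \<curlywedge> y) = x"
    and meet_absorb: "\<lbrakk>x \<in> carrier B; y \<in> carrier B\<rbrakk> \<Longrightarrow> x \<curlywedge> (x \<curlyvee> y) = x"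
    and join_lzero: "x \<in> carrier B \<Longrightarrow> x \<curlyvee> lzero B = x"
    and meet_lone: "x \<in> carrier B \<Longrightarrow> x \<curlywedge> lone B = x"
    and meet_join_distrib: "\<lbrakk>x \<in> carrier B; y \<in> carrier B; z \<in> carrier B\<rbrakk> \<Longrightarrow>
                       x \<curlywedge> (y \<curlyvee> z) = (x \<curlywedge> y) \<curlyvee> (x \<curlywedge> z)"
    and join_meet_distrib: "\<lbrakk>x \<in> carrier B; y \<in> carrier B; z \<in> carrier B\<rbrakk> \<Longrightarrow>
                       x \<curlyvee> (y \<curlywedge> z) = (x \<curlyvee> y) \<curlywedge> (x \<curlyvee> z)"
    and join_compl: "x \<in> carrier B \<Longrightarrow> x \<curlyvee> lcompl B x = lone B"
    and meet_compl: "x \<in> carrier B \<Longrightarrow> x \<curlywedge> lcompl B x = lzero B"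

text \<open>
  Whenever the carrier is a whole type, this is exactly the library notion
  \<^locale>\<open>abstract_boolean_algebra\<close>.
\<close>

lemma boolean_alg_UNIV_iff:
  assumes "carrier B = UNIV"
  shows "boolean_alg B \<longleftrightarrow>
    abstract_boolean_algebra (lmeet B) (ljoin B) (lcompl B) (lzero B) (lone B)"
proof
  assume "boolean_alg B"
  then interpret boolean_alg B .
  show "abstract_boolean_algebra (lmeet B) (ljoin B) (lcompl B) (lzero B) (lone B)"
    by unfold_locales
      (rule join_assoc meet_assoc join_comm meet_comm join_lzero meet_lone meet_join_distrib
        join_meet_distrib join_compl meet_compl; simp add: assms)+
next
  assume "abstract_boolean_algebra (lmeet B) (ljoin B) (lcompl B) (lzero B) (lone B)"
  then interpret A: abstract_boolean_algebra "lmeet B" "ljoin B" "lcompl B" "lzero B" "lone B" .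
  have absorb_join: "ljoin B x (lmeet B x y) = x" for x y
    by (metis A.conj_disj_distrib A.conj_one_right A.disj_one_right A.disj.commute)
  have absorb_meet: "lmeet B x (ljoin B x y) = x" for x y
    by (metis A.disj_conj_distrib A.disj_zero_right A.conj_zero_right A.conj.commute)
  show "boolean_alg B"
    by unfold_locales
      (simp add: assms | rule absorb_join absorb_meet A.conj.assoc A.disj.assoc A.conj.commute
        A.disj.commute A.conj_disj_distrib A.disj_conj_distrib)+
qed


section \<open>The lattice of a ring-like structure of events\<close>

definition LL :: "('a, 'b) ring_scheme \<Rightarrow> 'a ortho_algebra" where
  "LL R = \<lparr>carrier = carrier R,
           ljoin = (\<lambda>x y. (x \<oplus>\<^bsub>R\<^esub> \<one>\<^bsub>R\<^esub>) \<otimes>\<^bsub>R\<^esub> (y \<oplus>\<^bsub>R\<^esub> \<one>\<^bsub>R\<^esub>) \<oplus>\<^bsub>R\<^esub> \<one>\<^bsub>R\<^esub>),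
           lmeet = (\<lambda>x y. x \<otimes>\<^bsub>R\<^esub> y),
           lcompl = (\<lambda>x. x \<oplus>\<^bsub>R\<^esub> \<one>\<^bsub>R\<^esub>),
           lzero = \<zero>\<^bsub>R\<^esub>,
           lone = \<one>\<^bsub>R\<^esub>\<rparr>"

end

theory Submission
  imports Defs
begin

text \<open>
  For \<open>x \<le> y'\<close> axiom (R4) says \<open>x + y = x \<or> y\<close>, so (R5) turns addition in a specific structure
  into the symmetric difference \<open>x + y = (x \<and> y') \<or> (x' \<and> y)\<close> of the lattice. If the lattice is
  distributive, \<open>(x + y) + z\<close> expands to a disjunctive normal form that is invariant under
  permutations of \<open>x, y, z\<close>, which gives associativity. Conversely, in a Boolean ring
  \<open>x \<or> y = x + y + xy\<close>, and the Boolean laws are polynomial identities.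
\<close>

context rlse
begin

abbreviation cpl :: "'a \<Rightarrow> 'a" where
  "cpl x \<equiv> x \<oplus> \<one>"

abbreviation join :: "'a \<Rightarrow> 'a \<Rightarrow> 'a" where
  "join x y \<equiv> cpl (cpl x \<otimes> cpl y)"

lemma cpl_closed: "x \<in> carrier R \<Longrightarrow> cpl x \<in> carrier R"
  by (simp add: add_closed)

text \<open>Taking \<open>y = \<one>\<close> in \<open>R2\<close> leaves the square of
  \<open>cpl x\<close>, which idempotence removes.\<close>

lemma cpl_cpl: "x \<in> carrier R \<Longrightarrow> cpl (cpl x) = x"
  using R2[of x \<one>] by (simp add: cpl_closed mult_idem)

text \<open>For \<open>y \<le> x\<close> the product in \<open>R2\<close> is \<open>y\<close>, so
  \<open>R2\<close> reads \<open>cpl (cpl y \<otimes> cpl x) = x\<close>; complement both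
  sides.\<close>

lemma cpl_antimono:
  assumes "x \<in> carrier R" "y \<in> carrier R" "x \<otimes> y = y"
  shows "cpl y \<otimes> cpl x = cpl x"
  using R2[of x y] assms cpl_cpl[of "cpl y \<otimes> cpl x"] by (simp add: cpl_closed)

lemma cpl_zero: "cpl \<zero> = \<one>"
proof -
  have "cpl \<zero> \<otimes> \<one> = \<one>"
    using cpl_antimono[of "cpl \<one>" \<zero>]
    by (simp add: cpl_closed cpl_cpl mult_zero zero_in_carrier)
  then show ?thesis
    by (simp add: cpl_closed zero_in_carrier)
qed

lemma mult_cpl: "x \<in> carrier R \<Longrightarrow> x \<otimes> cpl x = \<zero>"
  using R3[of x \<zero>] by (simp add: mult_zero zero_in_carrier cpl_zero m_comm cpl_closed)

lemma add_eq_join: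
  assumes "x \<in> carrier R" "y \<in> carrier R" "cpl y \<otimes> x = x"
  shows "x \<oplus> y = join x y"
  using R4[of "cpl y" x] assms by (simp add: cpl_closed cpl_cpl)

end

context specific_rlse
begin

text \<open>No distributivity is involved: the summands in \<open>R5\<close> are orthogonal. From
  \<open>cpl x \<otimes> y \<le> cpl x\<close>, complementation gives
  \<open>x \<le> cpl (cpl x \<otimes> y)\<close>, and \<open>x \<otimes> cpl y\<close> lies below
  \<open>x\<close>. Hence \<open>add_eq_join\<close> applies.\<close>

lemma add_eq_symmetric_difference:
  assumes x: "x \<in> carrier R" and y: "y \<in> carrier R"
  shows "x \<oplus> y = join (x \<otimes> cpl y) (cpl x \<otimes> y)"
proof -
  have "cpl (cpl x \<otimes> y) \<otimes> x = x"
    using cpl_antimono[of "cpl x" "cpl x \<otimes> y"] x y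
    by (simp add: cpl_closed cpl_cpl mult_idem flip: m_assoc)
  then have "cpl (cpl x \<otimes> y) \<otimes> (x \<otimes> cpl y) = x \<otimes> cpl y"
    using x y by (simp add: cpl_closed flip: m_assoc)
  then show ?thesis
    using R5[OF x y] add_eq_join[of "x \<otimes> cpl y" "cpl x \<otimes> y"] x y by (simp add: cpl_closed)
qed

lemma boolean_ring_if_boolean_alg:
  assumes "boolean_alg (LL R)"
  shows "boolean_ring R"
proof -
  interpret B: boolean_alg "LL R" by fact
  note [simp] = cpl_closed cpl_cpl add_closed zero_in_carrier mult_zero mult_cpl cpl_zero
  have d: "x \<otimes> join y z = join (x \<otimes> y) (x \<otimes> z)"
    if "x \<in> carrier R" "y \<in> carrier R" "z \<in> carrier R" for x y z
    using B.meet_join_distrib that by (simp add: LL_def)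
  have d': "join y z \<otimes> x = join (y \<otimes> x) (z \<otimes> x)"
    if "x \<in> carrier R" "y \<in> carrier R" "z \<in> carrier R" for x y z
    using d that by (simp add: m_comm)
  have cpl1: "cpl \<one> = \<zero>"
    using cpl_cpl[of \<zero>] by simp
  have z: "\<zero> \<otimes> x = \<zero>" "cpl x \<otimes> x = \<zero>" if "x \<in> carrier R" for x
    using that m_comm[of \<zero> x] m_comm[of "cpl x" x] by simp_all
  \<comment> \<open>The disjunctive normal form of odd parity: exactly one of the three arguments
    holds, or all of them.\<close>
  define D where "D x y z = join (x \<otimes> (cpl y \<otimes> cpl z)) (join (y \<otimes> (cpl x \<otimes> cpl z))
      (join (z \<otimes> (cpl x \<otimes> cpl y)) (x \<otimes> (y \<otimes> z))))" for x y z
  \<comment> \<open>Expanding \<open>(x + y) + z\<close> also needs the complement of a sum. De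
    Morgan turns it into a product of joins, in whose expansion the terms
    \<open>cpl x \<otimes> x\<close> and \<open>y \<otimes> cpl y\<close> vanish.\<close>
  have cadd: "cpl (x \<oplus> y) = join (x \<otimes> y) (cpl x \<otimes> cpl y)"
    if [simp]: "x \<in> carrier R" "y \<in> carrier R" for x y
  proof -
    have "cpl (x \<oplus> y) = join (cpl x) y \<otimes> join x (cpl y)"
      by (simp add: add_eq_symmetric_difference[of x y])
    also have "\<dots> = join (cpl x \<otimes> join x (cpl y)) (y \<otimes> join x (cpl y))"
      by (rule d') simp_all
    also have "\<dots> = join (join (cpl x \<otimes> x) (cpl x \<otimes> cpl y)) (join (y \<otimes> x) (y \<otimes> cpl y))"
      by (simp only: d[of "cpl x" x "cpl y"] d[of y x "cpl y"] cpl_closed that)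
    also have "\<dots> = join (x \<otimes> y) (cpl x \<otimes> cpl y)"
      by (simp add: z m_comm)
    finally show ?thesis .
  qed
  have addD: "(x \<oplus> y) \<oplus> z = D x y z"
    if [simp]: "x \<in> carrier R" "y \<in> carrier R" "z \<in> carrier R" for x y z
  proof -
    have "(x \<oplus> y) \<oplus> z = join ((x \<oplus> y) \<otimes> cpl z) (cpl (x \<oplus> y) \<otimes> z)"
      by (rule add_eq_symmetric_difference) simp_all
    also have "\<dots> = join (join (x \<otimes> cpl y) (cpl x \<otimes> y) \<otimes> cpl z)
        (join (x \<otimes> y) (cpl x \<otimes> cpl y) \<otimes> z)"
      by (simp only: cadd that, simp only: add_eq_symmetric_difference[of x y] that)
    also have "\<dots> = join (join ((x \<otimes> cpl y) \<otimes> cpl z) ((cpl x \<otimes> y) \<otimes> cpl z))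
        (join ((x \<otimes> y) \<otimes> z) ((cpl x \<otimes> cpl y) \<otimes> z))"
      by (subst (1 2) d') simp_all
    also have "\<dots> = D x y z"
      unfolding D_def by (simp add: m_ac)
    finally show ?thesis .
  qed
  have assoc: "(x \<oplus> y) \<oplus> z = x \<oplus> (y \<oplus> z)"
    if [simp]: "x \<in> carrier R" "y \<in> carrier R" "z \<in> carrier R" for x y z
  proof -
    \<comment> \<open>Cyclic symmetry suffices, as \<open>R1\<close> turns
      \<open>x \<oplus> (y \<oplus> z)\<close> into \<open>(y \<oplus> z) \<oplus> x\<close>. Since
      \<open>join\<close> abbreviates a complemented product, \<open>cpl_cpl\<close> flattens nested
      joins and \<open>m_ac\<close> reorders them.\<close>
    have "D x y z = D y z x"
      unfolding D_def by (simp add: m_ac)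
    then show ?thesis
      using R1[of x "y \<oplus> z"] by (simp add: addD)
  qed
  have add_zero: "\<zero> \<oplus> x = x" if "x \<in> carrier R" for x
    using that by (simp add: add_eq_symmetric_difference[of \<zero> x] z cpl1)
  have add_self: "x \<oplus> x = \<zero>" if "x \<in> carrier R" for x
    using that by (simp add: add_eq_symmetric_difference[of x x] z cpl1)
  have distr: "x \<otimes> (y \<oplus> z) = x \<otimes> y \<oplus> x \<otimes> z"
    if [simp]: "x \<in> carrier R" "y \<in> carrier R" "z \<in> carrier R" for x y z
  proof -
    \<comment> \<open>Below \<open>x\<close>, complementing \<open>x \<otimes> z\<close> amounts to
      complementing \<open>z\<close>, because the part inside \<open>cpl x\<close> drops
      out.\<close>
    have *: "(x \<otimes> y) \<otimes> cpl (x \<otimes> z) = x \<otimes> (y \<otimes> cpl z)"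
      if [simp]: "y \<in> carrier R" "z \<in> carrier R" for y z
    proof -
      have "(x \<otimes> y) \<otimes> cpl (x \<otimes> z) = (x \<otimes> y) \<otimes> join (cpl x) (cpl z)"
        by simp
      also have "\<dots> = join ((x \<otimes> y) \<otimes> cpl x) ((x \<otimes> y) \<otimes> cpl z)"
        by (rule d) simp_all
      also have "(x \<otimes> y) \<otimes> cpl x = \<zero>"
        by (simp add: m_comm[of x y] m_assoc)
      finally show ?thesis
        by (simp add: m_assoc)
    qed
    have "x \<otimes> (y \<oplus> z) = join (x \<otimes> (y \<otimes> cpl z)) (x \<otimes> (cpl y \<otimes> z))"
      unfolding add_eq_symmetric_difference[OF that(2,3)] by (rule d) simp_all
    also have "\<dots> = join ((x \<otimes> y) \<otimes> cpl (x \<otimes> z)) (cpl (x \<otimes> y) \<otimes> (x \<otimes> z))"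
      using *[of y z] *[of z y] by (simp add: m_comm)
    also have "\<dots> = x \<otimes> y \<oplus> x \<otimes> z"
      by (rule add_eq_symmetric_difference[symmetric]) simp_all
    finally show ?thesis .
  qed
  \<comment> \<open>By \<open>add_self\<close>, each element is its own additive inverse.\<close>
  have "abelian_group R"
    by (rule abelian_groupI) (auto simp: assoc add_zero intro: R1 add_self)
  moreover have "monoid R"
    by (rule monoid_axioms)
  ultimately have "ring R"
    by (rule ringI) (simp_all add: distr m_comm)
  then show ?thesis
    by (intro boolean_ring.intro boolean_ring_axioms.intro mult_idem)
qed

lemma boolean_alg_if_boolean_ring:
  assumes "boolean_ring R"
  shows "boolean_alg (LL R)"
proof -
  interpret boolean_ring R by fact
  note [simp] = cpl_closed cpl_cpl mult_cpl
  \<comment> \<open>Up to commutativity, \<open>R2\<close> is the absorption law.\<close>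
  have absorb: "join x (x \<otimes> y) = x" if "x \<in> carrier R" "y \<in> carrier R" for x y
    using R2[of x y] that by (simp add: m_comm)
  \<comment> \<open>Characteristic 2 comes from expanding
    \<open>x \<otimes> (x \<oplus> \<one>) = \<zero>\<close>.\<close>
  have dbl: "x \<oplus> x = \<zero>" if "x \<in> carrier R" for x
    using that mult_cpl[of x] by (simp add: r_distr mult_idem)
  have join_eq: "join x y = x \<oplus> y \<oplus> x \<otimes> y"
    if [simp]: "x \<in> carrier R" "y \<in> carrier R" for x y
  proof -
    have "join x y = x \<oplus> y \<oplus> x \<otimes> y \<oplus> (\<one> \<oplus> \<one>)"
      by (simp add: l_distr r_distr a_ac)
    then show ?thesis
      by (simp add: dbl)
  qed
  have distr: "x \<otimes> join y z = join (x \<otimes> y) (x \<otimes> z)"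
    if [simp]: "x \<in> carrier R" "y \<in> carrier R" "z \<in> carrier R" for x y z
  proof -
    have "(x \<otimes> y) \<otimes> (x \<otimes> z) = (x \<otimes> x) \<otimes> (y \<otimes> z)"
      by (simp add: m_ac)
    then have "x \<otimes> (y \<oplus> z \<oplus> y \<otimes> z) = x \<otimes> y \<oplus> x \<otimes> z \<oplus> (x \<otimes> y) \<otimes> (x \<otimes> z)"
      by (simp add: r_distr mult_idem)
    then show ?thesis
      by (simp only: join_eq m_closed that)
  qed
  \<comment> \<open>The remaining laws are De Morgan duals, obtained by instantiating the proved
    ones at complements.\<close>
  have distr': "join x (y \<otimes> z) = join x y \<otimes> join x z"
    if [simp]: "x \<in> carrier R" "y \<in> carrier R" "z \<in> carrier R" for x y z
    using distr[of "cpl x" "cpl y" "cpl z"] by simp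
  have absorb': "x \<otimes> join x y = x" if [simp]: "x \<in> carrier R" "y \<in> carrier R" for x y
    using absorb[of "cpl x" "cpl y"] cpl_cpl[of "x \<otimes> join x y"] by simp
  show ?thesis
    by unfold_locales
      ((simp add: LL_def distr; fail) | (simp add: LL_def distr'; fail)
        | (simp add: LL_def m_assoc absorb absorb' cpl_zero; fail)
        | simp add: LL_def m_comm cpl_zero)+
qed

end

theorem corollary2p6:
  fixes R :: "('a, 'b) ring_scheme"
  assumes "specific_rlse R"
  shows "boolean_alg (LL R) \<longleftrightarrow> boolean_ring R"
  using specific_rlse.boolean_ring_if_boolean_alg[OF assms]
    specific_rlse.boolean_alg_if_boolean_ring[OF assms] by blast

end
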